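(* Let $p_t$, $t\ge0$, be the solution of the Fokker-Planck-Kolmogorov (FPK) equation $\partial_tp_t=\mathcal L_t^\ast p_t$ with $p_t\in L^2$ and initial density $p_0=p(\cdot,\theta_0)$ for some $\theta_0\in\Theta$, where $\mathrm{SM}(\hat q)=\{p(\cdot,\theta):\theta\in\Theta\}$ is a simple mixture family satisfying $$\sup_{t\ge0}\|\mathcal L_t^\ast p(\cdot,\theta)\|_2<\infty\quad\text{for all }\theta\in\Theta.$$ Assume that the functions $q_i-q_{n+1}$, $i=1,\dots,n$, are eigenfunctions of the operator $\mathcal L$ (the formal adjoint of the FPK operator $\mathcal L^\ast$), i.e. there is a constant $n\times n$ diagonal matrix $\Lambda$ with $\mathcal L_t(q-q_{n+1}\underline 1)=-\Lambda(q-q_{n+1}\underline1)$ for all $t\ge0$, and that $\mathrm{SM}(\hat q)$ is a simple mixture family for this choice. Let $\theta_t\in\Theta$ be the solution, starting at $\theta_0$, of the tangent projected equation in direct $L^2$ metric $$\dot\theta_t^i=\sum_{j=1}^n\gamma^{ij}\,E_{\theta_t}\left[\mathcal L_t(q_j-q_{n+1})\right],\qquad i=1,\dots,n.$$ Then, for every $t$ for which $\theta_t$ is defined, $p(\cdot,\theta_t)$ is the globally optimal approximation of $p_t$ in $\mathrm{SM}(\hat q)$ in the direct distance $d_D$, that is, $$\|p_t-p(\cdot,\theta_t)\|_2=\min_{\theta\in\Theta}\|p_t-p(\cdot,\theta)\|_2 .$$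
   Context: Consider the stochastic differential equation $dX_t=f(X_t,t)\,dt+\sigma(X_t,t)\,dW_t$ in $\mathbb R^N$, and let $a=\sigma\sigma'$ (prime denotes transpose). The FPK operator and its formal adjoint are $$\mathcal L_t^\ast p=-\sum_{i=1}^N\frac{\partial}{\partial x_i}[f_i(\cdot,t)p]+\frac12\sum_{i,j=1}^N\frac{\partial^2}{\partial x_i\partial x_j}[a_{ij}(\cdot,t)p],\qquad \mathcal L_t\varphi=\sum_{i=1}^N f_i(\cdot,t)\frac{\partial\varphi}{\partial x_i}+\frac12\sum_{i,j=1}^N a_{ij}(\cdot,t)\frac{\partial^2\varphi}{\partial x_i\partial x_j};$$ $\mathcal L$ is applied componentwise to vectors. The FPK equation $\partial_t p_t=\mathcal L_t^\ast p_t$ is the equation for the probability density $p_t$ of $X_t$. Simple mixture family: $\hat q=[q_1,\dots,q_{n+1}]'$ are $n+1$ fixed square integrable probability densities on $\mathbb R^N$, $q=[q_1,\dots,q_n]'$, $\underline1$ is the vector with $n$ components equal to $1$, $\hat\theta(\theta)=[\theta_1,\dots,\theta_n,1-\theta_1-\dots-\theta_n]'$, and $p(\cdot,\theta)=\hat\theta(\theta)'\hat q$ for $\theta\in\Theta$, where $\Theta$ is an open convex subset of $\mathbb R^n$ contained in $\{\theta:\theta_i\in[0,1]\ \forall i,\ 0<\sum_{i=1}^n\theta_i<1\}$. $E_\theta[\varphi]=\int\varphi(x)p(x,\theta)\,dx$ and $E_p[\varphi]=\int\varphi(x)p(x)\,dx$. The matrix $\gamma_{ij}=\langle q_i-q_{n+1},q_j-q_{n+1}\rangle$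 ($L^2$ inner product) is assumed positive definite, and $\gamma^{ij}$ are the entries of its inverse. The direct distance is $d_D(p_1,p_2)=\|p_1-p_2\|_2$ ($L^2$ norm). Standing convention: differentiation under the integral and integration by parts against $q_i-q_{n+1}$ are legitimate, so that $\frac{d}{dt}E_{p_t}[q-q_{n+1}\underline1]=E_{p_t}[\mathcal L_t(q-q_{n+1}\underline1)]$ for the FPK solution. *)

theory Defs
  imports "HOL-Analysis.Analysis"
begin

section \<open>Densities and the space L2\<close>

definition square_integrable :: "('a::euclidean_space \<Rightarrow> real) \<Rightarrow> bool" where
  "square_integrable g \<longleftrightarrow>
     g \<in> borel_measurable lborel \<and> integrable lborel (\<lambda>x. (g x)\<^sup>2)"

definition L2_inner :: "('a::euclidean_space \<Rightarrow> real) \<Rightarrow> ('a \<Rightarrow> real) \<Rightarrow> real" where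
  "L2_inner g h = (LINT x|lborel. g x * h x)"

definition L2_norm :: "('a::euclidean_space \<Rightarrow> real) \<Rightarrow> real" where
  "L2_norm g = sqrt (L2_inner g g)"

definition direct_dist :: "('a::euclidean_space \<Rightarrow> real) \<Rightarrow> ('a \<Rightarrow> real) \<Rightarrow> real" where
  "direct_dist p1 p2 = L2_norm (\<lambda>x. p1 x - p2 x)"

definition prob_density :: "('a::euclidean_space \<Rightarrow> real) \<Rightarrow> bool" where
  "prob_density p \<longleftrightarrow> (\<forall>x. 0 \<le> p x) \<and> has_bochner_integral lborel p 1"

definition expect :: "('a::euclidean_space \<Rightarrow> real) \<Rightarrow> ('a \<Rightarrow> real) \<Rightarrow> real" where
  "expect p \<phi> = (LINT x|lborel. \<phi> x * p x)"


section \<open>Partial derivatives\<close>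

text \<open>The function \<open>deriv\<close> is total, so the existence of the derivatives is recorded by separate
  predicates. Only existence is required; the order in which mixed derivatives are taken is
  immaterial below, since the matrix \<open>diffusion\<close> is symmetric.\<close>

definition partial_deriv :: "'N::finite \<Rightarrow> (real^'N \<Rightarrow> real) \<Rightarrow> real^'N \<Rightarrow> real" where
  "partial_deriv i g x = deriv (\<lambda>s. g (x + s *\<^sub>R axis i 1)) 0"

definition partial_exists :: "'N::finite \<Rightarrow> (real^'N \<Rightarrow> real) \<Rightarrow> bool" where
  "partial_exists i g \<longleftrightarrow> (\<forall>x. (\<lambda>s. g (x + s *\<^sub>R axis i 1)) field_differentiable at 0)"

definition partial2_exists :: "'N::finite \<Rightarrow> 'N \<Rightarrow> (real^'N \<Rightarrow> real) \<Rightarrow> bool" where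
  "partial2_exists i j g \<longleftrightarrow> partial_exists j g \<and> partial_exists i (partial_deriv j g)"


section \<open>The FPK operator and its formal adjoint\<close>

text \<open>Here \<open>f\<close> is the drift and \<open>\<sigma>\<close> the diffusion coefficient of
  \<open>dX = f (X, t) dt + \<sigma> (X, t) dW\<close>; the Brownian motion \<open>W\<close> may have any dimension \<open>CARD('m)\<close>.\<close>

definition diffusion ::
    "(real^'N::finite \<Rightarrow> real \<Rightarrow> real^'m::finite^'N) \<Rightarrow> real^'N \<Rightarrow> real \<Rightarrow> real^'N^'N" where
  "diffusion \<sigma> x t = \<sigma> x t ** transpose (\<sigma> x t)"

definition FPK_op ::
    "(real^'N::finite \<Rightarrow> real \<Rightarrow> real^'N) \<Rightarrow> (real^'N \<Rightarrow> real \<Rightarrow> real^'m::finite^'N) \<Rightarrow> real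
      \<Rightarrow> (real^'N \<Rightarrow> real) \<Rightarrow> real^'N \<Rightarrow> real" where
  "FPK_op f \<sigma> t p x =
     - (\<Sum>i\<in>UNIV. partial_deriv i (\<lambda>y. f y t $ i * p y) x)
     + 1/2 * (\<Sum>i\<in>UNIV. \<Sum>j\<in>UNIV.
         partial_deriv i (partial_deriv j (\<lambda>y. diffusion \<sigma> y t $ i $ j * p y)) x)"

definition FPK_op_defined ::
    "(real^'N::finite \<Rightarrow> real \<Rightarrow> real^'N) \<Rightarrow> (real^'N \<Rightarrow> real \<Rightarrow> real^'m::finite^'N) \<Rightarrow> real
      \<Rightarrow> (real^'N \<Rightarrow> real) \<Rightarrow> bool" where
  "FPK_op_defined f \<sigma> t p \<longleftrightarrow>
     (\<forall>i. partial_exists i (\<lambda>y. f y t $ i * p y)) \<and>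
     (\<forall>i j. partial2_exists i j (\<lambda>y. diffusion \<sigma> y t $ i $ j * p y))"

definition generator ::
    "(real^'N::finite \<Rightarrow> real \<Rightarrow> real^'N) \<Rightarrow> (real^'N \<Rightarrow> real \<Rightarrow> real^'m::finite^'N) \<Rightarrow> real
      \<Rightarrow> (real^'N \<Rightarrow> real) \<Rightarrow> real^'N \<Rightarrow> real" where
  "generator f \<sigma> t \<phi> x =
     (\<Sum>i\<in>UNIV. f x t $ i * partial_deriv i \<phi> x)
     + 1/2 * (\<Sum>i\<in>UNIV. \<Sum>j\<in>UNIV.
         diffusion \<sigma> x t $ i $ j * partial_deriv i (partial_deriv j \<phi>) x)"

definition generator_vec ::
    "(real^'N::finite \<Rightarrow> real \<Rightarrow> real^'N) \<Rightarrow> (real^'N \<Rightarrow> real \<Rightarrow> real^'m::finite^'N) \<Rightarrow> real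
      \<Rightarrow> (real^'N \<Rightarrow> real^'n::finite) \<Rightarrow> real^'N \<Rightarrow> real^'n" where
  "generator_vec f \<sigma> t \<phi> x = (\<chi> i. generator f \<sigma> t (\<lambda>y. \<phi> y $ i) x)"

text \<open>Classical solutions; the time derivative at \<open>t = 0\<close> is the right derivative.\<close>

definition FPK_solution ::
    "(real^'N::finite \<Rightarrow> real \<Rightarrow> real^'N) \<Rightarrow> (real^'N \<Rightarrow> real \<Rightarrow> real^'m::finite^'N)
      \<Rightarrow> (real \<Rightarrow> real^'N \<Rightarrow> real) \<Rightarrow> bool" where
  "FPK_solution f \<sigma> p \<longleftrightarrow>
     (\<forall>t\<ge>0. prob_density (p t) \<and> FPK_op_defined f \<sigma> t (p t) \<and>
       (\<forall>x. ((\<lambda>s. p s x) has_real_derivative FPK_op f \<sigma> t (p t) x) (at t within {0..})))"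

definition time_deriv :: "(real \<Rightarrow> 'a \<Rightarrow> real) \<Rightarrow> real \<Rightarrow> 'a \<Rightarrow> real" where
  "time_deriv p t x = vector_derivative (\<lambda>s. p s x) (at t within {0..})"


section \<open>Simple mixture families\<close>

text \<open>The \<open>n + 1\<close> densities are indexed by \<open>'n option\<close>, where \<open>n = CARD('n)\<close>: the index \<open>None\<close>
  stands for \<open>n + 1\<close>, the indices \<open>Some i\<close> for \<open>1, \<dots>, n\<close>. They are the components of a single
  vector-valued function.\<close>

definition theta_hat :: "real^'n::finite \<Rightarrow> real^'n option" where
  "theta_hat \<theta> = (\<chi> k. case k of Some i \<Rightarrow> \<theta> $ i | None \<Rightarrow> 1 - (\<Sum>i\<in>UNIV. \<theta> $ i))"

definition mixture ::
    "(real^'N::finite \<Rightarrow> real^'n::finite option) \<Rightarrow> real^'n \<Rightarrow> real^'N \<Rightarrow> real" where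
  "mixture q \<theta> x = theta_hat \<theta> \<bullet> q x"

text \<open>The vector \<open>[q\<^sub>1 - q\<^sub>n\<^sub>+\<^sub>1, \<dots>, q\<^sub>n - q\<^sub>n\<^sub>+\<^sub>1]'\<close>.\<close>

definition mixture_diff ::
    "(real^'N::finite \<Rightarrow> real^'n::finite option) \<Rightarrow> real^'N \<Rightarrow> real^'n" where
  "mixture_diff q x = (\<chi> i. q x $ Some i - q x $ None)"

definition mixture_metric ::
    "(real^'N::finite \<Rightarrow> real^'n::finite option) \<Rightarrow> real^'n^'n" where
  "mixture_metric q =
     (\<chi> i j. L2_inner (\<lambda>x. mixture_diff q x $ i) (\<lambda>x. mixture_diff q x $ j))"

definition positive_definite :: "real^'n::finite^'n \<Rightarrow> bool" where
  "positive_definite A \<longleftrightarrow> transpose A = A \<and> (\<forall>v. v \<noteq> 0 \<longrightarrow> v \<bullet> (A *v v) > 0)"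

definition diagonal_matrix :: "real^'n::finite^'n \<Rightarrow> bool" where
  "diagonal_matrix A \<longleftrightarrow> (\<forall>i j. i \<noteq> j \<longrightarrow> A $ i $ j = 0)"

definition simple_mixture_family ::
    "(real^'N::finite \<Rightarrow> real^'n::finite option) \<Rightarrow> (real^'n) set \<Rightarrow> bool" where
  "simple_mixture_family q \<Theta> \<longleftrightarrow>
     (\<forall>k. prob_density (\<lambda>x. q x $ k) \<and> square_integrable (\<lambda>x. q x $ k)) \<and>
     open \<Theta> \<and> convex \<Theta> \<and>
     \<Theta> \<subseteq> {\<theta>. (\<forall>i. \<theta> $ i \<in> {0..1}) \<and> 0 < (\<Sum>i\<in>UNIV. \<theta> $ i) \<and> (\<Sum>i\<in>UNIV. \<theta> $ i) < 1} \<and>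
     positive_definite (mixture_metric q)"

end

theory Submission
  imports Defs
begin

text \<open>
  Write \<open>u\<close> for the vector \<open>mixture_diff q\<close> and \<open>\<gamma>\<close> for its Gram matrix \<open>mixture_metric q\<close>.
  With \<open>\<theta>\<close> ranging over all of \<open>\<real>\<^sup>n\<close>, the mixtures fill the affine space through \<open>q\<^sub>n\<^sub>+\<^sub>1\<close> with directions \<open>u\<^sub>1, \<dots>, u\<^sub>n\<close>, so
  \<open>p(\<cdot>,\<theta>)\<close> is the closest mixture to a square integrable function \<open>g\<close> as soon as
  \<open>g - p(\<cdot>,\<theta>)\<close> is orthogonal to every \<open>u\<^sub>i\<close>, by Pythagoras
  (\<open>moment_match_imp_closest_mixture\<close>). Orthogonality means that \<open>g\<close> and \<open>p(\<cdot>,\<theta>)\<close> give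
  the same expectations to the \<open>u\<^sub>i\<close>, and the theorem reduces to the equality of these \<open>n\<close>
  moments for \<open>p\<^sub>t\<close> and \<open>p(\<cdot>,\<theta>\<^sub>t)\<close>.

  Let \<open>L\<close> be the generator. Both moment vectors solve the same linear equations. For
  \<open>p\<^sub>t\<close>, the adjoint relation gives
  \<open>d/dt E[u\<^sub>i] = E[L u\<^sub>i] = - \<Lambda>\<^sub>i\<^sub>i E[u\<^sub>i]\<close>: the eigenfunction property closes the moment
  equations. For \<open>p(\<cdot>,\<theta>\<^sub>t)\<close>, the moments are an affine function of \<open>\<theta>\<^sub>t\<close> with linear part
  \<open>\<gamma>\<close> (\<open>expect_mixture\<close>), and this cancels the inverse metric in the projected
  equation, leaving again \<open>E[L u\<^sub>i]\<close>. The difference of the \<open>i\<close>-th moments thus solves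
  \<open>m' = - \<Lambda>\<^sub>i\<^sub>i m\<close> and vanishes at time \<open>0\<close>, hence always (\<open>linear_ode_zero\<close>).
\<close>

section \<open>Square integrable functions\<close>

text \<open>The bound \<open>2 \<bar>g h\<bar> \<le> g\<^sup>2 + h\<^sup>2\<close> gives the integrability.\<close>

lemma square_integrable_mult_integrable:
  assumes g: "square_integrable g" and h: "square_integrable h"
  shows "integrable lborel (\<lambda>x. g x * h x)"
proof (rule Bochner_Integration.integrable_bound)
  show "integrable lborel (\<lambda>x. (g x)\<^sup>2 + (h x)\<^sup>2)"
    using g h by (auto simp: square_integrable_def)
  show "(\<lambda>x. g x * h x) \<in> borel_measurable lborel"
    using g h by (auto simp: square_integrable_def)
  have "\<bar>a * b\<bar> \<le> a\<^sup>2 + b\<^sup>2" for a b :: real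
  proof -
    have "2 * (\<bar>a\<bar> * \<bar>b\<bar>) \<le> a\<^sup>2 + b\<^sup>2" "0 \<le> \<bar>a\<bar> * \<bar>b\<bar>"
      using sum_squares_bound[of "\<bar>a\<bar>" "\<bar>b\<bar>"] by (simp_all add: mult.assoc)
    then show ?thesis
      unfolding abs_mult by linarith
  qed
  then show "AE x in lborel. norm (g x * h x) \<le> norm ((g x)\<^sup>2 + (h x)\<^sup>2)"
    by simp
qed

lemma square_integrable_add:
  assumes g: "square_integrable g" and h: "square_integrable h"
  shows "square_integrable (\<lambda>x. g x + h x)"
proof -
  have "integrable lborel (\<lambda>x. (g x)\<^sup>2 + (h x)\<^sup>2 + 2 * (g x * h x))"
    using g h square_integrable_mult_integrable[OF g h]
    by (intro Bochner_Integration.integrable_add integrable_mult_right)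
      (auto simp: square_integrable_def)
  moreover have "(\<lambda>x. (g x + h x)\<^sup>2) = (\<lambda>x. (g x)\<^sup>2 + (h x)\<^sup>2 + 2 * (g x * h x))"
    by (simp add: power2_sum mult.assoc)
  ultimately show ?thesis
    using g h by (auto simp: square_integrable_def)
qed

lemma square_integrable_scale:
  assumes "square_integrable g"
  shows "square_integrable (\<lambda>x. c * g x)"
  using assms by (auto simp: square_integrable_def power_mult_distrib)

lemma square_integrable_diff:
  assumes "square_integrable g" and "square_integrable h"
  shows "square_integrable (\<lambda>x. g x - h x)"
  using square_integrable_add[OF assms(1) square_integrable_scale[OF assms(2), of "-1"]] by simp

lemma square_integrable_sum:
  assumes "finite I" and "\<And>i. i \<in> I \<Longrightarrow> square_integrable (g i)"
  shows "square_integrable (\<lambda>x. \<Sum>i\<in>I. g i x)"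
  using assms
  by (induction I rule: finite_induct)
    (auto intro: square_integrable_add simp: square_integrable_def[of "\<lambda>x. 0"])

lemma L2_norm_le_add_orthogonal:
  assumes g: "square_integrable g" and h: "square_integrable h" and orth: "L2_inner g h = 0"
  shows "L2_norm g \<le> L2_norm (\<lambda>x. g x + h x)"
proof -
  have "L2_inner (\<lambda>x. g x + h x) (\<lambda>x. g x + h x)
      = (LINT x|lborel. (g x * g x + h x * h x) + 2 * (g x * h x))"
    unfolding L2_inner_def by (rule Bochner_Integration.integral_cong) (auto simp: algebra_simps)
  also have "\<dots> = L2_inner g g + L2_inner h h + 2 * L2_inner g h"
    using g h by (simp add: square_integrable_mult_integrable L2_inner_def)
  also have "\<dots> \<ge> L2_inner g g"
    using orth by (simp add: L2_inner_def)
  finally show ?thesis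
    by (simp add: L2_norm_def)
qed

section \<open>Geometry of a simple mixture family\<close>

lemma mixture_affine:
  "mixture q \<theta> x = q x $ None + (\<Sum>j\<in>UNIV. \<theta> $ j * mixture_diff q x $ j)"
proof -
  have "mixture q \<theta> x = (1 - (\<Sum>j\<in>UNIV. \<theta> $ j)) * q x $ None
      + (\<Sum>j\<in>UNIV. \<theta> $ j * q x $ Some j)"
    by (simp add: mixture_def theta_hat_def inner_vec_def UNIV_option_conv sum.reindex)
  also have "\<dots> = q x $ None + (\<Sum>j\<in>UNIV. \<theta> $ j * (q x $ Some j - q x $ None))"
    by (simp add: right_diff_distrib left_diff_distrib sum_subtractf sum_distrib_right)
  finally show ?thesis
    by (simp add: mixture_diff_def)
qed

lemma square_integrable_mixture_diff:
  assumes "simple_mixture_family q \<Theta>"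
  shows "square_integrable (\<lambda>x. mixture_diff q x $ i)"
  using assms by (simp add: simple_mixture_family_def mixture_diff_def square_integrable_diff)

lemma square_integrable_mixture:
  assumes "simple_mixture_family q \<Theta>"
  shows "square_integrable (mixture q \<theta>)"
proof -
  have "square_integrable (\<lambda>x. q x $ None + (\<Sum>j\<in>UNIV. \<theta> $ j * mixture_diff q x $ j))"
    using assms
    by (intro square_integrable_add square_integrable_sum square_integrable_scale
        square_integrable_mixture_diff) (auto simp: simple_mixture_family_def)
  then show ?thesis
    by (simp add: mixture_affine[abs_def])
qed

text \<open>By \<open>mixture_affine\<close>, moving \<open>\<theta>\<close> adds multiples of the differences, and the moments
  of the differences under each other are the entries of the Gram matrix.\<close>

lemma expect_mixture:
  assumes fam: "simple_mixture_family q \<Theta>"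
  shows "expect (mixture q \<theta>) (\<lambda>x. mixture_diff q x $ i)
    = expect (\<lambda>x. q x $ None) (\<lambda>x. mixture_diff q x $ i) + (mixture_metric q *v \<theta>) $ i"
proof -
  let ?u = "\<lambda>i x. mixture_diff q x $ i"
  note u = square_integrable_mixture_diff[OF fam]
  have q: "square_integrable (\<lambda>x. q x $ None)"
    using fam by (simp add: simple_mixture_family_def)
  have "expect (mixture q \<theta>) (?u i)
      = (LINT x|lborel. ?u i x * q x $ None + (\<Sum>j\<in>UNIV. (?u i x * ?u j x) * \<theta> $ j))"
    unfolding expect_def mixture_affine
    by (rule Bochner_Integration.integral_cong)
      (auto simp: distrib_left sum_distrib_left algebra_simps)
  also have "\<dots> = (LINT x|lborel. ?u i x * q x $ None)
      + (\<Sum>j\<in>UNIV. (LINT x|lborel. ?u i x * ?u j x) * \<theta> $ j)"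
    by (simp add: square_integrable_mult_integrable u q)
  finally show ?thesis
    by (simp add: expect_def matrix_vector_mult_def mixture_metric_def L2_inner_def)
qed

lemma positive_definite_imp_invertible:
  assumes "positive_definite A"
  shows "invertible A"
proof -
  have "\<forall>v. A *v v = 0 \<longrightarrow> v = 0"
    using assms by (metis inner_zero_right less_irrefl positive_definite_def)
  then show ?thesis
    by (simp add: invertible_left_inverse matrix_left_invertible_ker)
qed

text \<open>Moment matching is orthogonality of \<open>g - mixture q \<theta>\<close> to the directions of the affine
  space of mixtures, that is, to the difference of any two of them.\<close>

lemma moment_match_imp_closest_mixture:
  assumes fam: "simple_mixture_family q \<Theta>" and g: "square_integrable g"
    and match: "\<And>i. expect g (\<lambda>x. mixture_diff q x $ i)
      = expect (mixture q \<theta>) (\<lambda>x. mixture_diff q x $ i)"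
  shows "direct_dist g (mixture q \<theta>) \<le> direct_dist g (mixture q \<eta>)"
proof -
  let ?u = "\<lambda>i x. mixture_diff q x $ i"
  let ?r = "\<lambda>x. g x - mixture q \<theta> x"
  let ?d = "\<lambda>x. mixture q \<theta> x - mixture q \<eta> x"
  note u = square_integrable_mixture_diff[OF fam]
  note m = square_integrable_mixture[OF fam]
  have r: "square_integrable ?r" and d: "square_integrable ?d"
    by (simp_all add: square_integrable_diff g m)
  have orth: "(LINT x|lborel. ?r x * ?u j x) = 0" for j
  proof -
    have "(LINT x|lborel. ?r x * ?u j x)
        = (LINT x|lborel. ?u j x * g x - ?u j x * mixture q \<theta> x)"
      by (rule Bochner_Integration.integral_cong) (auto simp: algebra_simps)
    also have "\<dots> = expect g (?u j) - expect (mixture q \<theta>) (?u j)"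
      unfolding expect_def
      by (intro Bochner_Integration.integral_diff square_integrable_mult_integrable u g m)
    finally show ?thesis
      by (simp add: match)
  qed
  have "L2_inner ?r ?d
      = (LINT x|lborel. (\<Sum>j\<in>UNIV. (\<theta> $ j - \<eta> $ j) * (?r x * ?u j x)))"
    unfolding L2_inner_def
    by (rule Bochner_Integration.integral_cong)
      (auto simp: mixture_affine sum_subtractf[symmetric] sum_distrib_left
        left_diff_distrib[symmetric] mult.left_commute)
  also have "\<dots> = (\<Sum>j\<in>UNIV. (\<theta> $ j - \<eta> $ j) * (LINT x|lborel. ?r x * ?u j x))"
    by (simp add: square_integrable_mult_integrable r u)
  finally have "L2_inner ?r ?d = 0"
    by (simp add: orth)
  from L2_norm_le_add_orthogonal[OF r d this] show ?thesis
    by (simp add: direct_dist_def)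
qed

section \<open>Evolution of the moments\<close>

text \<open>The integrating factor \<open>exp (c * t)\<close> makes the product constant.\<close>

lemma linear_ode_zero:
  fixes y :: "real \<Rightarrow> real"
  assumes T: "is_interval T" "s \<in> T" and s: "y s = 0"
    and ode: "\<And>t. t \<in> T \<Longrightarrow> (y has_real_derivative - c * y t) (at t within T)"
    and t: "t \<in> T"
  shows "y t = 0"
proof -
  have "((\<lambda>t. exp (c * t) * y t) has_real_derivative 0) (at t within T)" if "t \<in> T" for t
    by (rule derivative_eq_intros ode[OF that] refl | simp)+
  then have "((\<lambda>t. exp (c * t) * y t) has_derivative (\<lambda>h. 0)) (at t within T)" if "t \<in> T" for t
    using that by (simp add: has_field_derivative_def lambda_zero)
  then obtain k where "\<And>t. t \<in> T \<Longrightarrow> exp (c * t) * y t = k"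
    using has_derivative_zero_constant[of T "\<lambda>t. exp (c * t) * y t"] is_interval_convex[OF T(1)]
    by blast
  from this[OF t] this[OF T(2)] show ?thesis
    by (simp add: s)
qed

lemma FPK_solution_time_deriv:
  assumes "FPK_solution f \<sigma> p" and "0 \<le> t"
  shows "time_deriv p t x = FPK_op f \<sigma> t (p t) x"
  unfolding time_deriv_def
proof (rule vector_derivative_within)
  \<comment> \<open>every time in \<open>{0..}\<close> is an accumulation point from the right, so the
    derivative within \<open>{0..}\<close> is unique even at \<open>0\<close>\<close>
  show "at t within {0..} \<noteq> bot"
    using at_within_Ici_at_right[of t] trivial_limit_at_right_real[of t] assms(2)
      at_le[of "{t..}" "{0..}" t] by (metis atLeast_subset_iff bot.extremum_uniqueI)
  show "((\<lambda>s. p s x) has_vector_derivative FPK_op f \<sigma> t (p t) x) (at t within {0..})"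
    using assms by (simp add: FPK_solution_def has_real_derivative_iff_has_vector_derivative)
qed

lemma expect_eigenfunction:
  assumes "diagonal_matrix \<Lambda>"
    and "\<And>x. generator_vec f \<sigma> t u x = - (\<Lambda> *v u x)"
  shows "expect g (generator f \<sigma> t (\<lambda>x. u x $ i)) = - (\<Lambda> $ i $ i) * expect g (\<lambda>x. u x $ i)"
proof -
  have "(\<Sum>j\<in>UNIV. \<Lambda> $ i $ j * v $ j) = \<Lambda> $ i $ i * v $ i" for v
  proof -
    have "(\<Sum>j\<in>UNIV. \<Lambda> $ i $ j * v $ j) = (\<Sum>j\<in>{i}. \<Lambda> $ i $ j * v $ j)"
      using assms(1) by (intro sum.mono_neutral_right) (auto simp: diagonal_matrix_def)
    then show ?thesis by simp
  qed
  then have "generator f \<sigma> t (\<lambda>x. u x $ i) x = - (\<Lambda> $ i $ i) * u x $ i" for x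
    using arg_cong[OF assms(2)[of x], of "\<lambda>v. v $ i"]
    by (simp add: generator_vec_def matrix_vector_mult_def)
  then show ?thesis
    by (simp add: expect_def mult.assoc)
qed

text \<open>Since the moments depend on \<open>\<theta>\<close> through \<open>mixture_metric q\<close>, the inverse metric that
  defines the projection cancels.\<close>

lemma expect_projected_has_derivative:
  assumes fam: "simple_mixture_family q \<Theta>"
    and ode: "(\<theta> has_vector_derivative
      (\<chi> i. \<Sum>j\<in>UNIV. matrix_inv (mixture_metric q) $ i $ j * v j)) F"
  shows "((\<lambda>s. expect (mixture q (\<theta> s)) (\<lambda>x. mixture_diff q x $ i)) has_real_derivative v i) F"
proof -
  let ?G = "mixture_metric q"
  have "invertible ?G"
    using fam by (simp add: simple_mixture_family_def positive_definite_imp_invertible)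
  then have "?G ** matrix_inv ?G = mat 1"
    unfolding invertible_def matrix_inv_def by (metis (mono_tags, lifting) someI_ex)
  then have "?G *v (matrix_inv ?G *v (\<chi> j. v j)) = (\<chi> j. v j)"
    by (simp add: matrix_vector_mul_assoc)
  moreover have "((\<lambda>s. (?G *v \<theta> s) $ i) has_vector_derivative
      (?G *v (matrix_inv ?G *v (\<chi> j. v j))) $ i) F"
    using bounded_linear.has_vector_derivative[OF
        bounded_linear_compose[OF bounded_linear_vec_nth[of i]
          matrix_vector_mul_bounded_linear[of ?G]] ode]
    by (simp add: matrix_vector_mult_def)
  ultimately have "((\<lambda>s. (?G *v \<theta> s) $ i) has_vector_derivative v i) F"
    by simp
  from has_vector_derivative_add[OF has_vector_derivative_const this] show ?thesis
    by (simp add: expect_mixture[OF fam] has_real_derivative_iff_has_vector_derivative)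
qed

section \<open>Optimality of the projected solution\<close>

theorem theorem4p6:
  fixes f :: "real^'N::finite \<Rightarrow> real \<Rightarrow> real^'N"
    and \<sigma> :: "real^'N \<Rightarrow> real \<Rightarrow> real^'m::finite^'N"
    and q :: "real^'N \<Rightarrow> real^'n::finite option"
    and \<Theta> :: "(real^'n) set"
    and p :: "real \<Rightarrow> real^'N \<Rightarrow> real"
    and \<theta>\<^sub>0 :: "real^'n"
    and \<Lambda> :: "real^'n^'n"
    and T :: "real set"
    and \<theta> :: "real \<Rightarrow> real^'n"
  assumes family: "simple_mixture_family q \<Theta>"
    and Lstar_defined: "\<forall>\<eta>\<in>\<Theta>. \<forall>t\<ge>0. FPK_op_defined f \<sigma> t (mixture q \<eta>)
           \<and> square_integrable (FPK_op f \<sigma> t (mixture q \<eta>))"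
    and Lstar_bounded:
      "\<forall>\<eta>\<in>\<Theta>. bdd_above ((\<lambda>t. L2_norm (FPK_op f \<sigma> t (mixture q \<eta>))) ` {0..})"
    and fpk: "FPK_solution f \<sigma> p"
    and p_L2: "\<forall>t\<ge>0. square_integrable (p t)"
    and \<theta>\<^sub>0: "\<theta>\<^sub>0 \<in> \<Theta>"
    and p_init: "p 0 = mixture q \<theta>\<^sub>0"
    and L_defined: "\<forall>i. (\<forall>k. partial_exists k (\<lambda>x. mixture_diff q x $ i))
           \<and> (\<forall>k l. partial2_exists k l (\<lambda>x. mixture_diff q x $ i))"
    and diag: "diagonal_matrix \<Lambda>"
    and eigen: "\<forall>t\<ge>0. \<forall>x. generator_vec f \<sigma> t (mixture_diff q) x = - (\<Lambda> *v mixture_diff q x)"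
    and diff_under_integral:
      "\<forall>t\<ge>0. \<forall>i. integrable lborel (\<lambda>x. mixture_diff q x $ i * time_deriv p t x)
         \<and> ((\<lambda>s. expect (p s) (\<lambda>x. mixture_diff q x $ i)) has_real_derivative
              (LINT x|lborel. mixture_diff q x $ i * time_deriv p t x)) (at t within {0..})"
    and integration_by_parts:
      "\<forall>t\<ge>0. \<forall>i. (LINT x|lborel. mixture_diff q x $ i * FPK_op f \<sigma> t (p t) x)
         = expect (p t) (generator f \<sigma> t (\<lambda>x. mixture_diff q x $ i))"
    and T: "is_interval T" "0 \<in> T" "T \<subseteq> {0..}"
    and \<theta>_init: "\<theta> 0 = \<theta>\<^sub>0"
    and \<theta>_in: "\<forall>t\<in>T. \<theta> t \<in> \<Theta>"
    and \<theta>_ode: "\<forall>t\<in>T. (\<theta> has_vector_derivative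
           (\<chi> i. \<Sum>j\<in>UNIV. matrix_inv (mixture_metric q) $ i $ j *
              expect (mixture q (\<theta> t)) (generator f \<sigma> t (\<lambda>x. mixture_diff q x $ j))))
         (at t within T)"
  shows "\<forall>t\<in>T. is_arg_min (\<lambda>\<eta>. direct_dist (p t) (mixture q \<eta>)) (\<lambda>\<eta>. \<eta> \<in> \<Theta>) (\<theta> t)"
proof
  fix t assume t: "t \<in> T"
  let ?u = "\<lambda>i x. mixture_diff q x $ i"
  let ?m = "\<lambda>i s. expect (p s) (?u i) - expect (mixture q (\<theta> s)) (?u i)"
  have "?m i t = 0" for i
  proof (rule linear_ode_zero[OF T(1,2) _ _ t])
    show "?m i 0 = 0"
      by (simp add: p_init \<theta>_init)
    fix s assume s: "s \<in> T"
    with T(3) have s0: "0 \<le> s" by auto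
    have gen: "expect g (generator f \<sigma> s (?u i)) = - (\<Lambda> $ i $ i) * expect g (?u i)" for g
      using eigen s0 by (intro expect_eigenfunction[OF diag]) auto
    have "(LINT x|lborel. ?u i x * time_deriv p s x) = expect (p s) (generator f \<sigma> s (?u i))"
      using integration_by_parts s0 by (simp add: FPK_solution_time_deriv[OF fpk s0])
    moreover have "((\<lambda>s. expect (p s) (?u i)) has_real_derivative
        (LINT x|lborel. ?u i x * time_deriv p s x)) (at s within {0..})"
      using diff_under_integral s0 by blast
    ultimately have "((\<lambda>s. expect (p s) (?u i)) has_real_derivative
        expect (p s) (generator f \<sigma> s (?u i))) (at s within {0..})"
      by simp
    from DERIV_diff[OF DERIV_subset[OF this T(3)]
        expect_projected_has_derivative[OF family \<theta>_ode[rule_format, OF s], where i = i]]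
    show "(?m i has_real_derivative - (\<Lambda> $ i $ i) * ?m i s) (at s within T)"
      by (simp add: gen algebra_simps)
  qed
  then have "direct_dist (p t) (mixture q (\<theta> t)) \<le> direct_dist (p t) (mixture q \<eta>)" for \<eta>
    using p_L2 t T(3) by (intro moment_match_imp_closest_mixture[OF family]) auto
  then show "is_arg_min (\<lambda>\<eta>. direct_dist (p t) (mixture q \<eta>)) (\<lambda>\<eta>. \<eta> \<in> \<Theta>) (\<theta> t)"
    using \<theta>_in t by (auto simp: is_arg_min_linorder)
qed

end
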